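(* Let $h\in\mathbb{R}$, $h\geq 0$, and $(h)\in R_{\mathcal G}$ be separating scales such that the smooth evolution $S^3\times\mathbb{R}\subset\mathbb{R}^4$ is hybrid with respect to them. Then this evolution is exotic smooth with respect to some exotic $\mathbb{R}^4$; i.e. the smooth structure on the topological manifold $\mathbb{R}^4$ in which the hybrid evolution takes place is an exotic smooth structure.
   Context: **Evolution.** The topological manifold $S^3\times\mathbb{R}$ is regarded as a topological submanifold of $\mathbb{R}^4$ with $(S^3\times\mathbb{R})\cup B^4=\mathbb{R}^4$, where $B^4$ is an open 4-ball. A smooth evolution $S^3\times\mathbb{R}\subset\mathbb{R}^4$ is one which respects a given smooth structure on the topological manifold $\mathbb{R}^4$ (the smooth structure in which the evolution takes place). **Separating scales.** $\mathcal{G}$ is the topos of germ-determined ideals (sheaves for the open-cover topology on the opposite of the category of finitely generated germ-determined $C^\infty$-rings) and $R_{\mathcal G}$ is its line object (the image of $\mathbb{R}$ under the embedding of smooth manifolds in $\mathcal{G}$). The scales have the following interpretation in the model: (A) when the diameter of $S^3$ is less than $h$ the smooth manifold $S^3\times\mathbb{R}$ is described internally in $\mathcal{G}$, and when the diameter is greater than $h$ it is the usual smooth manifold described in the category of sets; (B) for diameters smaller than $(h)$ the internal smooth manifold $S^3\times R_{\mathcal G}$ is locally modelled on $D_\infty^4=\bigcup_k\{x\in R_{\mathcal G}^4:\text{ any product of } k+1 \text{ coordinates of } x \text{ is } 0\}$. Corresponding to the separation, $\mathbb{R}^4$ has two open coordinate patches $\mathbb{R}^4_{<h}$ and $\mathbb{R}^4_{>h}$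 with $\mathbb{R}^4_{<h}\cup\mathbb{R}^4_{>h}=\mathbb{R}^4$ topologically, the first containing $S^3\times(-\infty,h+\epsilon_1)$ and the second containing $S^3\times(h-\epsilon_2,\infty)$ for some $\epsilon_1,\epsilon_2>0$. **Hybrid evolution.** A smooth evolution in $\mathbb{R}^4$ is hybrid (respects the existence of the separating $h$ and $(h)$) if: (i) the local coordinate patches $\mathbb{R}^4_{<h}$ and $\mathbb{R}^4_{>h}$ belong to some atlas of the smooth structure on $\mathbb{R}^4$ in which the evolution takes place; (ii) no such atlas is smoothly equivalent to an atlas consisting of a single global smooth chart on $\mathbb{R}^4$ (a homeomorphism of the manifold onto the standard $\mathbb{R}^4$). **Exotic.** The standard smooth structure on $\mathbb{R}^4$ is the one in which $\mathbb{R}\times\mathbb{R}\times\mathbb{R}\times\mathbb{R}$ is a smooth product. A smooth structure on the topological manifold $\mathbb{R}^4$ is exotic (the resulting manifold is an exotic $\mathbb{R}^4$) if the resulting smooth manifold, which is homeomorphic to $\mathbb{R}^4$, is not diffeomorphic to the standard smooth $\mathbb{R}^4$. *)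

theory Defs
  imports "HOL-Analysis.Analysis" "HOL-Algebra.QuotRing"
begin

section \<open>Smooth structures on topological 4-manifolds\<close>

primrec C_k_on :: "nat \<Rightarrow> 'a::real_normed_vector set \<Rightarrow> ('a \<Rightarrow> 'b::real_normed_vector) \<Rightarrow> bool" where
  "C_k_on 0 S f \<longleftrightarrow> continuous_on S f"
| "C_k_on (Suc k) S f \<longleftrightarrow>
     (\<forall>x\<in>S. f differentiable (at x)) \<and> (\<forall>v. C_k_on k S (\<lambda>x. frechet_derivative f (at x) v))"

text \<open>Only used for open sets of finite-dimensional spaces, where the iterated directional
  derivatives determine \<open>C\<^sup>k\<close>.\<close>

definition smooth_on :: "'a::real_normed_vector set \<Rightarrow> ('a \<Rightarrow> 'b::real_normed_vector) \<Rightarrow> bool" where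
  "smooth_on S f \<longleftrightarrow> (\<forall>k. C_k_on k S f)"

text \<open>The manifolds below are subsets of Euclidean spaces with the subspace topology, so the Hausdorff
  property and second countability need no separate mention. Only the values of a coordinate map
  on its domain matter.\<close>

type_synonym 'a chart = "'a set \<times> ('a \<Rightarrow> real^4)"

definition chart_on :: "'a::topological_space set \<Rightarrow> 'a chart \<Rightarrow> bool" where
  "chart_on M c \<longleftrightarrow> openin (top_of_set M) (fst c) \<and>
     (\<exists>V \<psi>. open V \<and> homeomorphism (fst c) V (snd c) \<psi>)"

definition smooth_transition :: "'a chart \<Rightarrow> 'a chart \<Rightarrow> bool" where
  "smooth_transition c d \<longleftrightarrow>
     smooth_on (snd c ` (fst c \<inter> fst d)) (snd d \<circ> the_inv_into (fst c) (snd c))"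

definition compatible :: "'a chart \<Rightarrow> 'a chart \<Rightarrow> bool" where
  "compatible c d \<longleftrightarrow> smooth_transition c d \<and> smooth_transition d c"

definition atlas :: "'a::topological_space set \<Rightarrow> 'a chart set \<Rightarrow> bool" where
  "atlas M \<U> \<longleftrightarrow> (\<forall>c\<in>\<U>. chart_on M c) \<and> \<Union>(fst ` \<U>) = M \<and> (\<forall>c\<in>\<U>. \<forall>d\<in>\<U>. compatible c d)"

definition smoothly_equivalent ::
    "'a::topological_space set \<Rightarrow> 'a chart set \<Rightarrow> 'a chart set \<Rightarrow> bool" where
  "smoothly_equivalent M \<U> \<V> \<longleftrightarrow> atlas M \<U> \<and> atlas M \<V> \<and> atlas M (\<U> \<union> \<V>)"

definition smooth_structure :: "'a::topological_space set \<Rightarrow> 'a chart set \<Rightarrow> bool" where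
  "smooth_structure M \<S> \<longleftrightarrow> atlas M \<S> \<and>
     (\<forall>c. chart_on M c \<and> (\<forall>d\<in>\<S>. compatible c d) \<longrightarrow> c \<in> \<S>)"

definition atlas_of :: "'a::topological_space set \<Rightarrow> 'a chart set \<Rightarrow> 'a chart set \<Rightarrow> bool" where
  "atlas_of M \<S> \<U> \<longleftrightarrow> atlas M \<U> \<and> \<U> \<subseteq> \<S>"

text \<open>The structure induced on an open subset.\<close>

definition restrict_structure :: "'a chart set \<Rightarrow> 'a set \<Rightarrow> 'a chart set" where
  "restrict_structure \<S> W = {c\<in>\<S>. fst c \<subseteq> W}"

definition smooth_map ::
    "'a::topological_space set \<Rightarrow> 'a chart set \<Rightarrow> 'b::topological_space set \<Rightarrow> 'b chart set \<Rightarrow>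
     ('a \<Rightarrow> 'b) \<Rightarrow> bool" where
  "smooth_map M \<S> N \<T> f \<longleftrightarrow> continuous_on M f \<and> f ` M \<subseteq> N \<and>
     (\<forall>c\<in>\<S>. \<forall>d\<in>\<T>. smooth_on (snd c ` {x \<in> fst c. f x \<in> fst d})
        (snd d \<circ> f \<circ> the_inv_into (fst c) (snd c)))"

definition diffeomorphism ::
    "'a::topological_space set \<Rightarrow> 'a chart set \<Rightarrow> 'b::topological_space set \<Rightarrow> 'b chart set \<Rightarrow>
     ('a \<Rightarrow> 'b) \<Rightarrow> ('b \<Rightarrow> 'a) \<Rightarrow> bool" where
  "diffeomorphism M \<S> N \<T> f g \<longleftrightarrow>
     homeomorphism M N f g \<and> smooth_map M \<S> N \<T> f \<and> smooth_map N \<T> M \<S> g"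

definition diffeomorphic ::
    "'a::topological_space set \<Rightarrow> 'a chart set \<Rightarrow> 'b::topological_space set \<Rightarrow> 'b chart set \<Rightarrow> bool" where
  "diffeomorphic M \<S> N \<T> \<longleftrightarrow> (\<exists>f g. diffeomorphism M \<S> N \<T> f g)"

text \<open>The product of the identity charts of the four factors is the identity chart of \<open>real^4\<close>;
  the standard structure consists of all charts compatible with it.\<close>

definition standard_structure :: "(real^4) chart set" where
  "standard_structure = {c. chart_on UNIV c \<and> compatible c (UNIV, \<lambda>x. x)}"

definition exotic_R4 :: "(real^4) chart set \<Rightarrow> bool" where
  "exotic_R4 \<S> \<longleftrightarrow> smooth_structure UNIV \<S> \<and> \<not> diffeomorphic UNIV \<S> UNIV standard_structure"


section \<open>The topos of germ-determined ideals\<close>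

text \<open>Points of \<open>\<real>\<^sup>n\<close> are the first \<open>n\<close> entries of a sequence. A function on \<open>\<real>\<^sup>n\<close> is one on sequences
  that depends on the first \<open>n\<close> entries only; for these, continuity in the product topology is
  continuity on \<open>\<real>\<^sup>n\<close>.\<close>

type_synonym point = "nat \<Rightarrow> real"
type_synonym coset = "(point \<Rightarrow> real) set"

primrec C_k_fun :: "nat \<Rightarrow> (point \<Rightarrow> real) \<Rightarrow> bool" where
  "C_k_fun 0 f \<longleftrightarrow> continuous_on UNIV f"
| "C_k_fun (Suc k) f \<longleftrightarrow> continuous_on UNIV f \<and>
     (\<forall>i. \<exists>g. (\<forall>x. ((\<lambda>t. f (x(i := t))) has_real_derivative g x) (at (x i))) \<and> C_k_fun k g)"

definition Cinf :: "nat \<Rightarrow> (point \<Rightarrow> real) ring" where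
  "Cinf n = \<lparr>carrier = {f. (\<forall>k. C_k_fun k f) \<and> (\<forall>x y. (\<forall>i<n. x i = y i) \<longrightarrow> f x = f y)},
     monoid.mult = (\<lambda>f g x. f x * g x), one = (\<lambda>x. 1),
     ring.zero = (\<lambda>x. 0), add = (\<lambda>f g x. f x + g x)\<rparr>"

definition zeros :: "(point \<Rightarrow> real) set \<Rightarrow> point set" where
  "zeros I = {x. \<forall>f\<in>I. f x = 0}"

definition germ_closure :: "nat \<Rightarrow> (point \<Rightarrow> real) set \<Rightarrow> (point \<Rightarrow> real) set" where
  "germ_closure n I = {f \<in> carrier (Cinf n).
     \<forall>x\<in>zeros I. \<exists>g\<in>I. \<forall>\<^sub>F y in nhds x. f y = g y}"

text \<open>\<open>(n, I)\<close> stands for the object of the opposite category given by \<open>C\<^sup>\<infinity>(\<real>\<^sup>n)/I\<close>.\<close>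

type_synonym locus = "nat \<times> (point \<Rightarrow> real) set"

definition locus :: "locus \<Rightarrow> bool" where
  "locus A \<longleftrightarrow> ideal (snd A) (Cinf (fst A)) \<and> germ_closure (fst A) (snd A) = snd A"

definition func_ring :: "locus \<Rightarrow> coset ring" where
  "func_ring A = Cinf (fst A) Quot snd A"

definition coset_of :: "locus \<Rightarrow> (point \<Rightarrow> real) \<Rightarrow> coset" where
  "coset_of A f = snd A +>\<^bsub>Cinf (fst A)\<^esub> f"

definition rep :: "coset \<Rightarrow> point \<Rightarrow> real" where
  "rep c = (SOME f. f \<in> c)"

definition point_map :: "(nat \<Rightarrow> coset) \<Rightarrow> point \<Rightarrow> point" where
  "point_map \<sigma> x = (\<lambda>j. rep (\<sigma> j) x)"

text \<open>An arrow \<open>A \<rightarrow> B\<close> is a homomorphism of \<open>C\<^sup>\<infinity>\<close>-rings \<open>C\<^sup>\<infinity>(\<real>\<^sup>m)/J \<rightarrow> C\<^sup>\<infinity>(\<real>\<^sup>n)/I\<close>, given by the images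
  \<open>\<sigma> 0, \<dots>, \<sigma> (m - 1)\<close> of the coordinates; these must send \<open>J\<close> into \<open>I\<close>. By Hadamard's lemma
  the choice of representatives is immaterial.\<close>

definition arrows :: "locus \<Rightarrow> locus \<Rightarrow> (nat \<Rightarrow> coset) set" where
  "arrows A B = {\<sigma> \<in> {..<fst B} \<rightarrow>\<^sub>E carrier (func_ring A).
     \<forall>g\<in>snd B. (\<lambda>x. g (point_map \<sigma> x)) \<in> snd A}"

text \<open>The composite of \<open>\<sigma> : A \<rightarrow> B\<close> with an arrow \<open>\<tau>\<close> from \<open>B\<close> into a locus with \<open>m\<close> generators.\<close>

definition pull :: "locus \<Rightarrow> nat \<Rightarrow> (nat \<Rightarrow> coset) \<Rightarrow> (nat \<Rightarrow> coset) \<Rightarrow> (nat \<Rightarrow> coset)" where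
  "pull A m \<sigma> \<tau> = (\<lambda>i\<in>{..<m}. coset_of A (\<lambda>x. rep (\<tau> i) (point_map \<sigma> x)))"

text \<open>The arrow \<open>B \<rightarrow> A\<close> given by the first \<open>fst A\<close> coordinates of \<open>B\<close>: the identity for \<open>B = A\<close>,
  and the inclusion of an open sublocus below.\<close>

definition incl :: "locus \<Rightarrow> locus \<Rightarrow> (nat \<Rightarrow> coset)" where
  "incl B A = (\<lambda>i\<in>{..<fst A}. coset_of B (\<lambda>x. x i))"

text \<open>The open sublocus \<open>{a \<noteq> 0}\<close>: the germ-determined ring obtained by inverting \<open>a\<close>, the
  inverse being the additional generator.\<close>

definition open_sub :: "locus \<Rightarrow> (point \<Rightarrow> real) \<Rightarrow> locus" where
  "open_sub A a = (Suc (fst A), germ_closure (Suc (fst A))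
     (Idl\<^bsub>Cinf (Suc (fst A))\<^esub> (snd A \<union> {\<lambda>x. x (fst A) * a x - 1})))"

text \<open>Every open subset of \<open>\<real>\<^sup>n\<close> is of the form \<open>{a \<noteq> 0}\<close>, so the following are the covers
  \<open>{open_sub A a \<rightarrow> A | a \<in> S}\<close> of the open-cover topology.\<close>

definition covers :: "locus \<Rightarrow> (point \<Rightarrow> real) set \<Rightarrow> bool" where
  "covers A S \<longleftrightarrow> S \<subseteq> carrier (Cinf (fst A)) \<and> (\<forall>x\<in>zeros (snd A). \<exists>a\<in>S. a x \<noteq> 0)"

record 'x presheaf =
  sections :: "locus \<Rightarrow> 'x set"
  restr :: "locus \<Rightarrow> locus \<Rightarrow> (nat \<Rightarrow> coset) \<Rightarrow> 'x \<Rightarrow> 'x"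

text \<open>\<open>restr P B A \<sigma>\<close> is the map \<open>P(A) \<rightarrow> P(B)\<close> induced by \<open>\<sigma> : B \<rightarrow> A\<close>.\<close>

definition is_presheaf :: "'x presheaf \<Rightarrow> bool" where
  "is_presheaf P \<longleftrightarrow>
     (\<forall>A B \<sigma>. locus A \<and> locus B \<and> \<sigma> \<in> arrows B A \<longrightarrow>
        restr P B A \<sigma> \<in> sections P A \<rightarrow> sections P B) \<and>
     (\<forall>A. locus A \<longrightarrow> (\<forall>s\<in>sections P A. restr P A A (incl A A) s = s)) \<and>
     (\<forall>A B C \<sigma> \<tau>. locus A \<and> locus B \<and> locus C \<and> \<sigma> \<in> arrows B A \<and> \<tau> \<in> arrows C B \<longrightarrow>
        (\<forall>s\<in>sections P A. restr P C A (pull C (fst A) \<tau> \<sigma>) s = restr P C B \<tau> (restr P B A \<sigma> s)))"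

definition matching_family ::
    "'x presheaf \<Rightarrow> locus \<Rightarrow> (point \<Rightarrow> real) set \<Rightarrow> ((point \<Rightarrow> real) \<Rightarrow> 'x) \<Rightarrow> bool" where
  "matching_family P A S s \<longleftrightarrow> (\<forall>a\<in>S. s a \<in> sections P (open_sub A a)) \<and>
     (\<forall>a\<in>S. \<forall>b\<in>S. \<forall>C. locus C \<longrightarrow>
       (\<forall>\<sigma>\<in>arrows C (open_sub A a). \<forall>\<tau>\<in>arrows C (open_sub A b).
          pull C (fst A) \<sigma> (incl (open_sub A a) A) = pull C (fst A) \<tau> (incl (open_sub A b) A) \<longrightarrow>
          restr P C (open_sub A a) \<sigma> (s a) = restr P C (open_sub A b) \<tau> (s b)))"

definition object_of_G :: "'x presheaf \<Rightarrow> bool" where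
  "object_of_G P \<longleftrightarrow> is_presheaf P \<and>
     (\<forall>A S s. locus A \<and> covers A S \<and> matching_family P A S s \<longrightarrow>
        (\<exists>!t. t \<in> sections P A \<and>
           (\<forall>a\<in>S. restr P (open_sub A a) A (incl (open_sub A a) A) t = s a)))"

definition isomorphic_in_G :: "'x presheaf \<Rightarrow> 'y presheaf \<Rightarrow> bool" where
  "isomorphic_in_G P Q \<longleftrightarrow> (\<exists>\<phi>.
     (\<forall>A. locus A \<longrightarrow> bij_betw (\<phi> A) (sections P A) (sections Q A)) \<and>
     (\<forall>A B. locus A \<and> locus B \<longrightarrow> (\<forall>\<sigma>\<in>arrows B A. \<forall>s\<in>sections P A.
        \<phi> B (restr P B A \<sigma> s) = restr Q B A \<sigma> (\<phi> A s))))"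

text \<open>The embedding of manifolds into the topos, for a closed submanifold \<open>M\<close> of \<open>\<real>\<^sup>m\<close>: it is the
  sheaf represented by \<open>C\<^sup>\<infinity>(M) = C\<^sup>\<infinity>(\<real>\<^sup>m)/{f. f vanishes on M}\<close>.\<close>

definition embed_manifold :: "nat \<Rightarrow> point set \<Rightarrow> (nat \<Rightarrow> coset) presheaf" where
  "embed_manifold m M =
    (let L = (m, {f \<in> carrier (Cinf m). \<forall>x\<in>M. f x = 0}) in
     \<lparr>sections = (\<lambda>A. arrows A L), restr = (\<lambda>B A \<sigma> \<tau>. pull B m \<sigma> \<tau>)\<rparr>)"

definition R_G_pow :: "nat \<Rightarrow> (nat \<Rightarrow> coset) presheaf" where
  "R_G_pow m = embed_manifold m UNIV"

abbreviation R_G :: "(nat \<Rightarrow> coset) presheaf" where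
  "R_G \<equiv> R_G_pow 1"

text \<open>The embedding preserves products, so \<open>S\<^sup>3 \<times> R_G\<close> is the image of \<open>S\<^sup>3 \<times> \<real> \<subseteq> \<real>\<^sup>5\<close>; entry 4 is the
  \<open>R_G\<close>-coordinate.\<close>

definition S3_times_R_G :: "(nat \<Rightarrow> coset) presheaf" where
  "S3_times_R_G = embed_manifold 5 {x. (\<Sum>i<4. (x i)\<^sup>2) = 1}"

text \<open>The order of \<open>R_G\<close>: the difference of the two elements of \<open>C\<^sup>\<infinity>(\<real>\<^sup>n)/I\<close> lies in the image of
  the open half-line, i.e. is positive at the zeros of the germ-determined ideal \<open>I\<close>.\<close>

definition less_in_G :: "locus \<Rightarrow> coset \<Rightarrow> coset \<Rightarrow> bool" where
  "less_in_G A c d \<longleftrightarrow> (\<forall>x\<in>zeros (snd A). rep c x < rep d x)"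

definition D_order :: "nat \<Rightarrow> nat \<Rightarrow> locus \<Rightarrow> (nat \<Rightarrow> coset) set" where
  "D_order k m A = {\<sigma> \<in> sections (R_G_pow m) A.
     \<forall>J\<in>{..k} \<rightarrow> {..<m}. finprod (func_ring A) (\<lambda>j. \<sigma> (J j)) {..k} = \<zero>\<^bsub>func_ring A\<^esub>}"

text \<open>A union of subsheaves consists of the sections that lie locally in one of them.\<close>

definition D_infinity :: "nat \<Rightarrow> locus \<Rightarrow> (nat \<Rightarrow> coset) set" where
  "D_infinity m A = {\<sigma> \<in> sections (R_G_pow m) A. \<exists>S. covers A S \<and>
     (\<forall>a\<in>S. \<exists>k. pull (open_sub A a) m (incl (open_sub A a) A) \<sigma> \<in> D_order k m (open_sub A a))}"

text \<open>The infinitesimal neighbourhood of a (generalised) point \<open>x\<close> of \<open>S\<^sup>3 \<times> R_G\<close>.\<close>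

definition monad_at :: "locus \<Rightarrow> (nat \<Rightarrow> coset) \<Rightarrow> (nat \<Rightarrow> coset) set" where
  "monad_at A x = {y \<in> sections S3_times_R_G A.
     (\<lambda>i\<in>{..<5}. y i \<ominus>\<^bsub>func_ring A\<^esub> x i) \<in> D_infinity 5 A}"

text \<open>At stage \<open>B\<close>: the infinitesimal neighbourhood of \<open>x\<close> is isomorphic to \<open>D_infinity 4\<close>, as
  sheaves over \<open>B\<close>.\<close>

definition monad_iso_D_infinity :: "locus \<Rightarrow> (nat \<Rightarrow> coset) \<Rightarrow> bool" where
  "monad_iso_D_infinity B x \<longleftrightarrow> (\<exists>\<phi>.
     (\<forall>C. locus C \<longrightarrow> (\<forall>\<sigma>\<in>arrows C B.
        bij_betw (\<phi> C \<sigma>) (D_infinity 4 C) (monad_at C (pull C 5 \<sigma> x)))) \<and>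
     (\<forall>C C'. locus C \<and> locus C' \<longrightarrow> (\<forall>\<sigma>\<in>arrows C B. \<forall>\<tau>\<in>arrows C' C. \<forall>d\<in>D_infinity 4 C.
        \<phi> C' (pull C' (fst B) \<tau> \<sigma>) (pull C' 4 \<tau> d) = pull C' 5 \<tau> (\<phi> C \<sigma> d))))"

text \<open>The internal statement ``every point of \<open>S\<^sup>3 \<times> R_G\<close> whose \<open>R_G\<close>-coordinate is below \<open>\<eta>\<close> has an
  infinitesimal neighbourhood isomorphic to \<open>D_infinity 4\<close>'', for a generalised element \<open>\<eta>\<close> of
  \<open>R_G\<close> at stage \<open>A\<close>, unfolded by Kripke-Joyal forcing.\<close>

definition modelled_on_D_infinity_below :: "locus \<Rightarrow> (nat \<Rightarrow> coset) \<Rightarrow> bool" where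
  "modelled_on_D_infinity_below A \<eta> \<longleftrightarrow>
     (\<forall>B. locus B \<longrightarrow> (\<forall>\<sigma>\<in>arrows B A. \<forall>x\<in>sections S3_times_R_G B.
        less_in_G B (x 4) (pull B 1 \<sigma> \<eta> 0) \<longrightarrow>
        (\<exists>S. covers B S \<and> (\<forall>b\<in>S.
           monad_iso_D_infinity (open_sub B b) (pull (open_sub B b) 5 (incl (open_sub B b) B) x)))))"


section \<open>Evolutions and separating scales\<close>

definition S3_times_R :: "((real^4) \<times> real) set" where
  "S3_times_R = sphere 0 1 \<times> UNIV"

text \<open>\<open>\<S>\<close> is the smooth structure on the topological manifold \<open>\<real>\<^sup>4\<close> in which the evolution takes place.
  It need not induce the product structure on \<open>S\<^sup>3 \<times> \<real>\<close>, hence the separate structure \<open>\<T>\<close>.\<close>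

definition smooth_evolution ::
    "(real^4) chart set \<Rightarrow> ((real^4) \<times> real) chart set \<Rightarrow> ((real^4) \<times> real \<Rightarrow> real^4) \<Rightarrow>
     (real^4) set \<Rightarrow> bool" where
  "smooth_evolution \<S> \<T> j B \<longleftrightarrow>
     smooth_structure UNIV \<S> \<and> smooth_structure S3_times_R \<T> \<and>
     open (j ` S3_times_R) \<and>
     (\<exists>g. diffeomorphism S3_times_R \<T>
        (j ` S3_times_R) (restrict_structure \<S> (j ` S3_times_R)) j g) \<and>
     open B \<and> B homeomorphic ball (0 :: real^4) 1 \<and>
     j ` S3_times_R \<union> B = UNIV"

text \<open>A description of \<open>S\<^sup>3 \<times> \<real>\<close> is either an object of the topos or a smooth manifold in the category
  of sets.\<close>

datatype description =
    In_G "(nat \<Rightarrow> coset) presheaf"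
  | In_Sets "((real^4) \<times> real) set" "((real^4) \<times> real) chart set"

definition described_at_scales ::
    "real \<Rightarrow> ((real^4) \<times> real) chart set \<Rightarrow> (real \<Rightarrow> description) \<Rightarrow> bool" where
  "described_at_scales h \<T> \<Delta> \<longleftrightarrow>
     (\<forall>d<h. \<exists>X. \<Delta> d = In_G X \<and> object_of_G X \<and> isomorphic_in_G X S3_times_R_G) \<and>
     (\<forall>d>h. \<Delta> d = In_Sets S3_times_R \<T>)"

text \<open>\<open>c\<^sub>1\<close> and \<open>c\<^sub>2\<close> are the coordinate patches below and above \<open>h\<close>; the internal scale \<open>\<eta>\<close> is a
  generalised element of \<open>R_G\<close>, at an arbitrary stage \<open>A\<close>, since the only global elements
  are the real numbers.\<close>

definition separating_scales ::
    "real \<Rightarrow> locus \<Rightarrow> (nat \<Rightarrow> coset) \<Rightarrow> ((real^4) \<times> real) chart set \<Rightarrow> ((real^4) \<times> real \<Rightarrow> real^4) \<Rightarrow>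
     (real \<Rightarrow> description) \<Rightarrow> (real^4) chart \<Rightarrow> (real^4) chart \<Rightarrow> bool" where
  "separating_scales h A \<eta> \<T> j \<Delta> c\<^sub>1 c\<^sub>2 \<longleftrightarrow>
     described_at_scales h \<T> \<Delta> \<and>
     modelled_on_D_infinity_below A \<eta> \<and>
     chart_on UNIV c\<^sub>1 \<and> chart_on UNIV c\<^sub>2 \<and> fst c\<^sub>1 \<union> fst c\<^sub>2 = UNIV \<and>
     (\<exists>\<epsilon>\<^sub>1>0. \<exists>\<epsilon>\<^sub>2>0. j ` (sphere 0 1 \<times> {..<h + \<epsilon>\<^sub>1}) \<subseteq> fst c\<^sub>1 \<and>
        j ` (sphere 0 1 \<times> {h - \<epsilon>\<^sub>2<..}) \<subseteq> fst c\<^sub>2)"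

definition hybrid :: "(real^4) chart set \<Rightarrow> (real^4) chart \<Rightarrow> (real^4) chart \<Rightarrow> bool" where
  "hybrid \<S> c\<^sub>1 c\<^sub>2 \<longleftrightarrow>
     (\<exists>\<U>. atlas_of UNIV \<S> \<U> \<and> c\<^sub>1 \<in> \<U> \<and> c\<^sub>2 \<in> \<U>) \<and>
     (\<forall>\<U>. atlas_of UNIV \<S> \<U> \<and> c\<^sub>1 \<in> \<U> \<and> c\<^sub>2 \<in> \<U> \<longrightarrow>
        \<not> (\<exists>f g. homeomorphism UNIV UNIV f g \<and> smoothly_equivalent UNIV \<U> {(UNIV, f)}))"

end

theory Submission
  imports Defs
begin

text \<open>A diffeomorphism \<open>f\<close> from \<open>\<real>\<^sup>4\<close> with a structure \<open>\<S>\<close> onto the standard \<open>\<real>\<^sup>4\<close> is the same thing as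
  a global chart of \<open>\<S>\<close> with image all of \<open>\<real>\<^sup>4\<close>: read through the identity chart of the standard
  structure, smoothness of \<open>f\<close> and of its inverse in the charts of \<open>\<S>\<close> is literally smoothness of
  the coordinate changes between \<open>(UNIV, f)\<close> and those charts. A smooth structure is maximal, so
  \<open>(UNIV, f)\<close> then belongs to it (\<open>diffeomorphism_to_standard_is_chart\<close>), and every atlas of \<open>\<S>\<close> is
  smoothly equivalent to this single global chart (\<open>atlases_of_structure_equivalent\<close>). A hybrid
  evolution comes with an atlas containing the patches below and above the separating scale, and
  forbids any such atlas to be equivalent to one global chart. Hence its structure cannot be
  diffeomorphic to the standard one.\<close>

lemma smooth_on_const: "smooth_on S (\<lambda>_. c)"
proof -
  have "C_k_on k S (\<lambda>_. c)" for k
    by (induction k arbitrary: c) auto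
  then show ?thesis
    by (simp add: smooth_on_def)
qed

lemma smooth_on_ident: "smooth_on S (\<lambda>x. x)"
proof -
  have "C_k_on k S (\<lambda>x. x)" for k
    using smooth_on_const by (cases k) (auto simp: smooth_on_def frechet_derivative_ident)
  then show ?thesis
    by (simp add: smooth_on_def)
qed

lemma the_inv_into_ident: "the_inv_into UNIV (\<lambda>x. x) = (\<lambda>x. x)"
  by (rule ext) (simp add: the_inv_into_f_eq)

lemma chart_on_global:
  assumes "homeomorphism UNIV UNIV f g"
  shows "chart_on UNIV (UNIV, f)"
  using assms by (auto simp: chart_on_def intro!: exI[of _ UNIV])

lemma identity_chart_in_standard: "(UNIV, \<lambda>x. x) \<in> standard_structure"
  using smooth_on_ident chart_on_global[OF homeomorphism_ident]
  by (auto simp: standard_structure_def compatible_def smooth_transition_def the_inv_into_ident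
      comp_def)

text \<open>The two smoothness conditions on a diffeomorphism, tested against the identity chart of the
  target, are the two smooth transition conditions; maximality of the structure does the rest.\<close>

lemma diffeomorphism_to_standard_is_chart:
  assumes \<S>: "smooth_structure UNIV \<S>"
    and fg: "diffeomorphism UNIV \<S> UNIV standard_structure f g"
  shows "(UNIV, f) \<in> \<S>"
proof -
  have hom: "homeomorphism UNIV UNIV f g"
    and f: "smooth_map UNIV \<S> UNIV standard_structure f"
    and g: "smooth_map UNIV standard_structure UNIV \<S> g"
    using fg by (auto simp: diffeomorphism_def)
  have gf: "g (f x) = x" and fg': "f (g y) = y" for x y
    using hom by (auto simp: homeomorphism_def)
  have inv: "the_inv_into UNIV f = g"
    by (rule ext) (simp add: fg' gf inj_on_inverseI[of UNIV g f] the_inv_into_f_eq)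
  have "compatible (UNIV, f) d" if d: "d \<in> \<S>" for d
  proof -
    have preimage: "{y. g y \<in> fst d} = f ` fst d"
      by (auto simp: gf) (metis fg' imageI)
    have "smooth_on (snd d ` {x \<in> fst d. f x \<in> UNIV}) ((\<lambda>x. x) \<circ> f \<circ> the_inv_into (fst d) (snd d))"
      using bspec[OF bspec[OF conjunct2[OF conjunct2[OF f[unfolded smooth_map_def]]] d]
          identity_chart_in_standard] by (simp only: fst_conv snd_conv)
    then have "smooth_transition d (UNIV, f)"
      by (simp add: smooth_transition_def comp_def)
    moreover have "smooth_on ((\<lambda>x. x) ` {y \<in> UNIV. g y \<in> fst d})
        (snd d \<circ> g \<circ> the_inv_into UNIV (\<lambda>x. x))"
      using bspec[OF bspec[OF conjunct2[OF conjunct2[OF g[unfolded smooth_map_def]]]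
          identity_chart_in_standard] d] by (simp only: fst_conv snd_conv UNIV_I simp_thms)
    then have "smooth_transition (UNIV, f) d"
      by (simp add: smooth_transition_def comp_def the_inv_into_ident preimage inv)
    ultimately show ?thesis
      by (simp add: compatible_def)
  qed
  then show ?thesis
    using \<S> chart_on_global[OF hom] unfolding smooth_structure_def by blast
qed

lemma atlas_within_structure:
  assumes "smooth_structure M \<S>" and "\<U> \<subseteq> \<S>" and "\<Union>(fst ` \<U>) = M"
  shows "atlas M \<U>"
  using assms unfolding smooth_structure_def atlas_def by (meson subsetD)

lemma atlases_of_structure_equivalent:
  assumes \<S>: "smooth_structure M \<S>"
    and \<U>: "atlas_of M \<S> \<U>" and \<V>: "atlas_of M \<S> \<V>"
  shows "smoothly_equivalent M \<U> \<V>"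
proof -
  have "\<Union>(fst ` \<U>) = M" and "\<Union>(fst ` \<V>) = M"
    using \<U> \<V> unfolding atlas_of_def atlas_def by blast+
  then have "\<Union>(fst ` (\<U> \<union> \<V>)) = M"
    by (simp only: image_Un Union_Un_distrib Un_absorb)
  moreover have "\<U> \<union> \<V> \<subseteq> \<S>"
    using \<U> \<V> by (simp add: atlas_of_def)
  ultimately have "atlas M (\<U> \<union> \<V>)"
    by (intro atlas_within_structure[OF \<S>])
  with \<U> \<V> show ?thesis
    by (simp add: smoothly_equivalent_def atlas_of_def)
qed

lemma global_chart_atlas_of:
  assumes "smooth_structure UNIV \<S>" and "(UNIV, f) \<in> \<S>"
  shows "atlas_of UNIV \<S> {(UNIV, f)}"
  using assms by (simp add: atlas_of_def atlas_within_structure)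

theorem theorem4:
  fixes h :: real
    and A :: locus and \<eta> :: "nat \<Rightarrow> coset"
    and \<S> :: "(real^4) chart set"
    and \<T> :: "((real^4) \<times> real) chart set"
    and j :: "(real^4) \<times> real \<Rightarrow> real^4"
    and B :: "(real^4) set"
    and \<Delta> :: "real \<Rightarrow> description"
    and c\<^sub>1 c\<^sub>2 :: "(real^4) chart"
  assumes "h \<ge> 0"
    and "locus A" and "\<eta> \<in> sections R_G A"
    and "smooth_evolution \<S> \<T> j B"
    and "separating_scales h A \<eta> \<T> j \<Delta> c\<^sub>1 c\<^sub>2"
    and "hybrid \<S> c\<^sub>1 c\<^sub>2"
  shows "exotic_R4 \<S>"
proof -
  have \<S>: "smooth_structure UNIV \<S>"
    using \<open>smooth_evolution \<S> \<T> j B\<close> by (simp add: smooth_evolution_def)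
  have "\<not> diffeomorphic UNIV \<S> UNIV standard_structure"
  proof
    assume "diffeomorphic UNIV \<S> UNIV standard_structure"
    then obtain f g where fg: "diffeomorphism UNIV \<S> UNIV standard_structure f g"
      by (auto simp: diffeomorphic_def)
    obtain \<U> where \<U>: "atlas_of UNIV \<S> \<U>" "c\<^sub>1 \<in> \<U>" "c\<^sub>2 \<in> \<U>"
      using \<open>hybrid \<S> c\<^sub>1 c\<^sub>2\<close> by (auto simp: hybrid_def)
    have "smoothly_equivalent UNIV \<U> {(UNIV, f)}"
      using atlases_of_structure_equivalent[OF \<S> \<U>(1)] global_chart_atlas_of[OF \<S>]
        diffeomorphism_to_standard_is_chart[OF \<S> fg] by blast
    moreover have "homeomorphism UNIV UNIV f g"
      using fg by (simp add: diffeomorphism_def)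
    ultimately show False
      using \<open>hybrid \<S> c\<^sub>1 c\<^sub>2\<close> \<U> unfolding hybrid_def by blast
  qed
  with \<S> show ?thesis
    by (simp add: exotic_R4_def)
qed

end
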